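(* Let $\Bbbk$ be a field and $0\ne v\in\Bbbk$ with $[n]!\ne0$ in $\Bbbk$. Let $\alpha$ be a $1$-factor of length less than $n$ with $d=i_\alpha$ defects. Then: (a) $\eta(\alpha^+)=\Phi_1\eta(\alpha)$. (b) If $d>0$ and $[d]\ne0$ then $\eta(\alpha^-)=\frac1{[d]}\Phi_2\eta(\alpha)-\sum_{j=1}^{d-1}\frac{[j]}{[d]}\Phi_1\eta(\alpha^{(j)})$.
   Context: Quantum integers: for $k\ge0$, $[k]=\sum_{t=0}^{k-1}v^{k-1-2t}\in\Bbbk$, $[-k]=-[k]$, $[k]!=[1][2]\cdots[k]$, $[0]!=1$. $V$ is the two-dimensional space with basis $y_1,y_{-1}$ and operators $Fy_1=y_{-1}$, $Fy_{-1}=0$, $Ky_{\pm1}=v^{\pm1}y_{\pm1}$. On $V^{\otimes m}$, $F$ acts as $\sum_{j=1}^m1^{\otimes(j-1)}\otimes F\otimes(K^{-1})^{\otimes(m-j)}$; $y_{i_1}\otimes\cdots\otimes y_{i_m}$ ($i_j\in\{\pm1\}$) has weight $\sum_ji_j$. ($V^{\otimes0}=\Bbbk$, of weight $0$, with $F=0$.) For $b\in V^{\otimes(m-1)}$ of weight $i_b$, $\Phi_1(b)=b\otimes y_1$ and $\Phi_2(b)=[i_b]\,b\otimes y_{-1}-v^{i_b}Fb\otimes y_1$. A $1$-factor of length $l$ is a sequence $\alpha=(\alpha_1,\dots,\alpha_l)$ with $\alpha_i=\pm1$ and all partial sums $\alpha_1+\cdots+\alpha_i\ge0$; $i_\alpha$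 is the sum of its entries. If $\alpha_i=1$ and $j$ is the smallest index with $i<j\le l$ and $\alpha_i+\cdots+\alpha_j=0$, then $(i,j)$ is a pairing of $\alpha$; unpaired indices are called defects (there are $i_\alpha$ of them). $\alpha^+$, $\alpha^-$ denote $\alpha$ with $1$, respectively $-1$, appended at the end. For $1\le j\le i_\alpha-1$, $\alpha^{(j)}$ is the $1$-factor obtained by pairing the $j$th defect of $\alpha$ with the next one (changing the entry at the $(j+1)$st defect to $-1$). $\eta(\alpha)\in V^{\otimes l}$ is the tensor product, in order, of a factor $y_1$ for each defect and of nested links; explicitly: $\eta(\emptyset)=1$; if index $1$ is a defect, $\eta(\alpha)=y_1\otimes\eta(\alpha_2,\dots,\alpha_l)$; if $1$ is paired with $j$, $\eta(\alpha)=\Psi(\eta(\alpha_2,\dots,\alpha_{j-1}))\otimes\eta(\alpha_{j+1},\dots,\alpha_l)$, where $\Psi(b)=y_1\otimes b\otimes y_{-1}-v\,y_{-1}\otimes b\otimes y_1$. It has weight $i_\alpha$. *)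

theory Defs
  imports Complex_Main "HOL-Library.Function_Algebras"
begin

definition qint :: "'k::field \<Rightarrow> int \<Rightarrow> 'k" where
  "qint v k =
     (if k \<ge> 0 then (\<Sum>t<nat k. v powi (k - 1 - 2 * int t))
      else - (\<Sum>t<nat (-k). v powi (-k - 1 - 2 * int t)))"

definition qfact :: "'k::field \<Rightarrow> nat \<Rightarrow> 'k" where
  "qfact v n = (\<Prod>k=1..n. qint v (int k))"

text \<open>
  The space \<open>V\<^sup>\<otimes>\<^sup>m\<close> is represented in coordinates: a vector is the function sending a word
  \<open>[i\<^sub>1, \<dots>, i\<^sub>m]\<close> with letters \<open>1, -1\<close> to the coefficient of \<open>y\<^sub>i\<^sub>1 \<otimes> \<dots> \<otimes> y\<^sub>i\<^sub>m\<close>, and all other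
  lists to \<open>0\<close>; \<open>yvec i\<close> is the basis vector \<open>y\<^sub>i\<close>. The spaces for different \<open>m\<close> live in one common type, so that \<open>\<otimes>\<close> is the
  multiplication of the tensor algebra of \<open>V\<close>. Addition of vectors is pointwise
  (\<open>Function_Algebras\<close>).
\<close>

type_synonym 'k tensor = "int list \<Rightarrow> 'k"

definition words :: "nat \<Rightarrow> int list set" where
  "words m = {w. length w = m \<and> set w \<subseteq> {1, -1}}"

definition scale :: "'k::field \<Rightarrow> 'k tensor \<Rightarrow> 'k tensor" (infixr "\<cdot>\<^sub>t" 75) where
  "c \<cdot>\<^sub>t b = (\<lambda>w. c * b w)"

definition tensor :: "'k::field tensor \<Rightarrow> 'k tensor \<Rightarrow> 'k tensor" (infixr "\<otimes>\<^sub>t" 78) where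
  "b \<otimes>\<^sub>t c = (\<lambda>w. \<Sum>i\<le>length w. b (take i w) * c (drop i w))"

definition tone :: "'k::field tensor" where
  "tone = (\<lambda>w. if w = [] then 1 else 0)"

definition yvec :: "int \<Rightarrow> 'k::field tensor" where
  "yvec i = (\<lambda>w. if w = [i] then 1 else 0)"

text \<open>Linear operators on \<open>V\<close> are given by their values on the basis vectors \<open>yvec i\<close>, \<open>i = 1, -1\<close>;
  in particular \<open>yvec\<close> itself is the identity operator.\<close>

definition F_V :: "int \<Rightarrow> 'k::field tensor" where
  "F_V i = (if i = 1 then yvec (-1) else 0)"

definition Kinv_V :: "'k::field \<Rightarrow> int \<Rightarrow> 'k tensor" where
  "Kinv_V v i = v powi (-i) \<cdot>\<^sub>t yvec i"

text \<open>\<open>op_tensor [A\<^sub>1, \<dots>, A\<^sub>m] [i\<^sub>1, \<dots>, i\<^sub>m]\<close> is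
  \<open>(A\<^sub>1 \<otimes> \<dots> \<otimes> A\<^sub>m) (y\<^sub>i\<^sub>1 \<otimes> \<dots> \<otimes> y\<^sub>i\<^sub>m) = A\<^sub>1 y\<^sub>i\<^sub>1 \<otimes> \<dots> \<otimes> A\<^sub>m y\<^sub>i\<^sub>m\<close>.\<close>

definition op_tensor :: "(int \<Rightarrow> 'k::field tensor) list \<Rightarrow> int list \<Rightarrow> 'k tensor" where
  "op_tensor As w = foldr (\<otimes>\<^sub>t) (map2 (\<lambda>A i. A i) As w) tone"

definition F_word :: "'k::field \<Rightarrow> int list \<Rightarrow> 'k tensor" where
  "F_word v w =
     (\<Sum>j=1..length w.
        op_tensor (replicate (j - 1) yvec @ [F_V] @ replicate (length w - j) (Kinv_V v)) w)"

text \<open>The linear extension of \<open>F_word\<close>. As \<open>F_word\<close> preserves the length of words, only the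
  words of length \<open>length u\<close> contribute to the coefficient at \<open>u\<close>.\<close>

definition F_act :: "'k::field \<Rightarrow> 'k tensor \<Rightarrow> 'k tensor" where
  "F_act v b = (\<lambda>u. \<Sum>w\<in>words (length u). b w * F_word v w u)"

definition has_weight :: "'k::field tensor \<Rightarrow> int \<Rightarrow> bool" where
  "has_weight b i \<longleftrightarrow> (\<forall>w. b w \<noteq> 0 \<longrightarrow> sum_list w = i)"

text \<open>The weight is unique for nonzero weight vectors. For \<open>b = 0\<close> it is unspecified, but then
  \<open>Phi2 v b = 0\<close> whatever its value.\<close>

definition wt :: "'k::field tensor \<Rightarrow> int" where
  "wt b = (THE i. has_weight b i)"

definition Phi1 :: "'k::field tensor \<Rightarrow> 'k tensor" where
  "Phi1 b = b \<otimes>\<^sub>t yvec 1"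

definition Phi2 :: "'k::field \<Rightarrow> 'k tensor \<Rightarrow> 'k tensor" where
  "Phi2 v b = qint v (wt b) \<cdot>\<^sub>t (b \<otimes>\<^sub>t yvec (-1)) - v powi (wt b) \<cdot>\<^sub>t (F_act v b \<otimes>\<^sub>t yvec 1)"

text \<open>\<open>1\<close>-factors are lists, so positions are counted from \<open>0\<close>. The number \<open>i\<^sub>\<alpha>\<close> is
  \<open>sum_list \<alpha>\<close>.\<close>

definition one_factor :: "int list \<Rightarrow> bool" where
  "one_factor \<alpha> \<longleftrightarrow> set \<alpha> \<subseteq> {1, -1} \<and> (\<forall>i\<le>length \<alpha>. sum_list (take i \<alpha>) \<ge> 0)"

definition pairing :: "int list \<Rightarrow> nat \<Rightarrow> nat \<Rightarrow> bool" where
  "pairing \<alpha> i j \<longleftrightarrow>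
     i < j \<and> j < length \<alpha> \<and> \<alpha> ! i = 1 \<and> (\<Sum>k=i..j. \<alpha> ! k) = 0 \<and>
     (\<forall>j'. i < j' \<and> j' < j \<longrightarrow> (\<Sum>k=i..j'. \<alpha> ! k) \<noteq> 0)"

definition defect :: "int list \<Rightarrow> nat \<Rightarrow> bool" where
  "defect \<alpha> i \<longleftrightarrow> i < length \<alpha> \<and> \<not> (\<exists>j. pairing \<alpha> i j \<or> pairing \<alpha> j i)"

definition defects :: "int list \<Rightarrow> nat list" where
  "defects \<alpha> = filter (defect \<alpha>) [0..<length \<alpha>]"

text \<open>\<open>pair_defect \<alpha> j\<close> is \<open>\<alpha>\<^sup>(\<^sup>j\<^sup>)\<close> for \<open>1 \<le> j \<le> i\<^sub>\<alpha> - 1\<close>; here \<open>defects \<alpha> ! j\<close> is the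
  \<open>(j+1)\<close>st defect.\<close>

definition pair_defect :: "int list \<Rightarrow> nat \<Rightarrow> int list" where
  "pair_defect \<alpha> j = \<alpha>[defects \<alpha> ! j := -1]"

definition Psi :: "'k::field \<Rightarrow> 'k tensor \<Rightarrow> 'k tensor" where
  "Psi v b = yvec 1 \<otimes>\<^sub>t b \<otimes>\<^sub>t yvec (-1) - v \<cdot>\<^sub>t (yvec (-1) \<otimes>\<^sub>t b \<otimes>\<^sub>t yvec 1)"

text \<open>Only meaningful for \<open>1\<close>-factors: there a first position that is not a defect is the left
  end of a pairing.\<close>

function eta :: "'k::field \<Rightarrow> int list \<Rightarrow> 'k tensor" where
  "eta v [] = tone"
| "eta v (x # xs) =
     (if defect (x # xs) 0 then yvec 1 \<otimes>\<^sub>t eta v xs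
      else let j = (THE j. pairing (x # xs) 0 j)
           in Psi v (eta v (take (j - 1) xs)) \<otimes>\<^sub>t eta v (drop j xs))"
  by pat_completeness auto
termination by (relation "measure (\<lambda>(v, \<alpha>). length \<alpha>)") auto

end

theory Submission
  imports Defs
begin

text \<open>
  A \<open>1\<close>-factor with \<open>d\<close> defects has the form \<open>\<beta>\<^sub>0 1 \<beta>\<^sub>1 1 \<dots> 1 \<beta>\<^sub>d\<close> with balanced words \<open>\<beta>\<^sub>i\<close>
  (\<open>1\<close>-factors of sum \<open>0\<close>) and the displayed letters \<open>1\<close> as its defects. Pairings never cross the
  end of a balanced word or a defect, so \<open>eta\<close> is multiplicative on concatenations of
  \<open>1\<close>-factors (\<open>eta_append\<close>). Appending a further defect therefore multiplies \<open>eta\<close> by \<open>y\<^sub>1\<close>,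
  which is the first claim.

  For the second claim write \<open>\<alpha> = \<alpha>' 1 \<beta>\<close> with the last defect displayed. Appending \<open>-1\<close> turns
  \<open>1 \<beta>\<close> into a link around \<open>\<beta>\<close>, hence
  \<open>eta \<alpha>\<^sup>- = eta \<alpha> \<otimes> y\<^sub>-\<^sub>1 - v X \<otimes> y\<^sub>1\<close> with \<open>X = eta \<alpha>' \<otimes> y\<^sub>-\<^sub>1 \<otimes> eta \<beta>\<close>
  (\<open>eta_minus_last\<close>). Multiplied by \<open>[d]\<close> and compared with the definition of \<open>Phi2\<close>, the claim
  becomes, after cancelling a right factor \<open>y\<^sub>1\<close>,
  \<open>v\<^sup>d F (eta \<alpha>) + (\<Sum>j=1..d-1. [j] eta \<alpha>\<^sup>(\<^sup>j\<^sup>)) = v [d] X\<close>.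

  The reason for this identity: \<open>F\<close> is a twisted derivation (\<open>F_act_tensor\<close>) that kills
  \<open>eta\<close> of balanced words (\<open>F_act_eta_balanced\<close>). If \<open>X\<^sub>i\<close> denotes \<open>eta \<alpha>\<close> with the \<open>i\<close>th defect
  replaced by \<open>y\<^sub>-\<^sub>1\<close>, then \<open>v\<^sup>d F (eta \<alpha>) = (\<Sum>i. v\<^sup>i X\<^sub>i)\<close> and \<open>eta \<alpha>\<^sup>(\<^sup>j\<^sup>) = X\<^sub>j\<^sub>+\<^sub>1 - v X\<^sub>j\<close>, and the sum
  telescopes to the multiple \<open>v [d]\<close> of \<open>X = X\<^sub>d\<close> because \<open>v [i] = v\<^sup>i + [i-1]\<close> (\<open>qint_Suc\<close>).
  The proof in \<open>F_act_eta_plus_paired\<close> carries this out by induction on the number of defects,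
  removing the last one, so that the vectors \<open>X\<^sub>i\<close> with \<open>i < d\<close> never have to be named.
\<close>

section \<open>The tensor algebra in coordinates\<close>

lemma scale_apply: "(r \<cdot>\<^sub>t b) w = r * b w"
  by (simp add: scale_def)

lemma scale_zero [simp]: "r \<cdot>\<^sub>t 0 = 0"
  by (rule ext) (simp add: scale_apply)

lemma sum_tensor_apply: "(\<Sum>j\<in>J. f j :: 'k::field tensor) w = (\<Sum>j\<in>J. f j w)"
  by (induction J rule: infinite_finite_induct) simp_all

lemma tensor_Nil: "(b \<otimes>\<^sub>t c) [] = b [] * c []"
  by (simp add: tensor_def)

text \<open>
  The workhorse for coordinate proofs. Passing from \<open>b\<close> to \<open>\<lambda>w. b (x # w)\<close> is the contraction of the
  first tensor factor with the dual basis vector of \<open>y\<^sub>x\<close>; it reduces the length of the words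
  at which two tensors are compared, so identities can be proved by induction on the word.
\<close>

lemma tensor_Cons: "(b \<otimes>\<^sub>t c) (x # u) = b [] * c (x # u) + ((\<lambda>w. b (x # w)) \<otimes>\<^sub>t c) u"
  by (simp add: tensor_def sum.atMost_Suc_shift del: sum.atMost_Suc)

lemma tensor_add_left: "(a + b) \<otimes>\<^sub>t c = a \<otimes>\<^sub>t c + b \<otimes>\<^sub>t c"
  by (rule ext) (simp add: tensor_def plus_fun_def distrib_right sum.distrib)

lemma tensor_add_right: "c \<otimes>\<^sub>t (a + b) = c \<otimes>\<^sub>t a + c \<otimes>\<^sub>t b"
  by (rule ext) (simp add: tensor_def plus_fun_def distrib_left sum.distrib)

lemma tensor_diff_left: "(a - b) \<otimes>\<^sub>t c = a \<otimes>\<^sub>t c - b \<otimes>\<^sub>t c"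
  by (rule ext) (simp add: tensor_def fun_diff_def left_diff_distrib sum_subtractf)

lemma tensor_diff_right: "c \<otimes>\<^sub>t (a - b) = c \<otimes>\<^sub>t a - c \<otimes>\<^sub>t b"
  by (rule ext) (simp add: tensor_def fun_diff_def right_diff_distrib sum_subtractf)

lemma tensor_scale_left: "(r \<cdot>\<^sub>t b) \<otimes>\<^sub>t c = r \<cdot>\<^sub>t (b \<otimes>\<^sub>t c)"
  by (rule ext) (simp add: tensor_def scale_def sum_distrib_left mult_ac)

lemma tensor_scale_right: "b \<otimes>\<^sub>t (r \<cdot>\<^sub>t c) = r \<cdot>\<^sub>t (b \<otimes>\<^sub>t c)"
  by (rule ext) (simp add: tensor_def scale_def sum_distrib_left mult_ac)

lemma tensor_zero_left [simp]: "0 \<otimes>\<^sub>t c = 0"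
  by (rule ext) (simp add: tensor_def)

lemma tensor_zero_right [simp]: "c \<otimes>\<^sub>t 0 = 0"
  by (rule ext) (simp add: tensor_def)

lemma tensor_sum_left: "(\<Sum>j\<in>J. f j) \<otimes>\<^sub>t c = (\<Sum>j\<in>J. f j \<otimes>\<^sub>t c)"
  by (induction J rule: infinite_finite_induct) (simp_all only: sum.infinite sum.empty sum.insert tensor_add_left tensor_zero_left not_False_eq_True)

lemma tensor_sum_right: "c \<otimes>\<^sub>t (\<Sum>j\<in>J. f j) = (\<Sum>j\<in>J. c \<otimes>\<^sub>t f j)"
  by (induction J rule: infinite_finite_induct) (simp_all only: sum.infinite sum.empty sum.insert tensor_add_right tensor_zero_right not_False_eq_True)

lemma tensor_assoc: "(a \<otimes>\<^sub>t b) \<otimes>\<^sub>t c = a \<otimes>\<^sub>t b \<otimes>\<^sub>t c"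
proof
  show "((a \<otimes>\<^sub>t b) \<otimes>\<^sub>t c) w = (a \<otimes>\<^sub>t b \<otimes>\<^sub>t c) w" for w
  proof (induction w arbitrary: a)
    case Nil
    show ?case by (simp add: tensor_Nil)
  next
    case (Cons x u)
    have "(\<lambda>w. (a \<otimes>\<^sub>t b) (x # w)) = a [] \<cdot>\<^sub>t (\<lambda>w. b (x # w)) + (\<lambda>w. a (x # w)) \<otimes>\<^sub>t b"
      by (rule ext) (simp add: tensor_Cons scale_def)
    then show ?case
      by (simp add: tensor_Cons tensor_Nil tensor_add_left tensor_scale_left Cons.IH
          scale_apply distrib_left)
  qed
qed

lemma tone_tensor [simp]: "tone \<otimes>\<^sub>t b = b"
proof
  have "(\<lambda>w. tone (x # w)) = (0 :: 'a tensor)" for x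
    by (simp add: tone_def zero_fun_def)
  then show "(tone \<otimes>\<^sub>t b) w = b w" for w
    by (cases w) (simp_all add: tensor_Nil tensor_Cons tone_def)
qed

lemma tensor_tone [simp]: "b \<otimes>\<^sub>t tone = b"
proof
  show "(b \<otimes>\<^sub>t tone) w = b w" for w
    by (induction w arbitrary: b) (simp_all add: tensor_Nil tensor_Cons, simp_all add: tone_def)
qed

lemma yvec_tensor_Nil: "(yvec i \<otimes>\<^sub>t b) [] = 0"
  by (simp add: tensor_Nil yvec_def)

lemma yvec_tensor_Cons: "(yvec i \<otimes>\<^sub>t b) (x # u) = (if x = i then b u else 0)"
proof -
  have "(\<lambda>w. yvec i (x # w)) = (if x = i then tone else (0 :: 'a tensor))"
    by (auto simp: yvec_def tone_def)
  then show ?thesis by (simp add: tensor_Cons yvec_def)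
qed

section \<open>Weight vectors\<close>

text \<open>
  The support condition is added to the weight condition because \<open>F_act\<close> ignores coefficients at
  lists with letters other than \<open>1, -1\<close>.
\<close>

definition homogeneous :: "int \<Rightarrow> 'k::field tensor \<Rightarrow> bool" where
  "homogeneous i b \<longleftrightarrow> has_weight b i \<and> (\<forall>w. b w \<noteq> 0 \<longrightarrow> set w \<subseteq> {1, -1})"

lemma homogeneousI:
  "(\<And>w. b w \<noteq> 0 \<Longrightarrow> sum_list w = i \<and> set w \<subseteq> {1, -1}) \<Longrightarrow> homogeneous i b"
  by (auto simp: homogeneous_def has_weight_def)

lemma homogeneousD:
  "homogeneous i b \<Longrightarrow> b w \<noteq> 0 \<Longrightarrow> sum_list w = i \<and> set w \<subseteq> {1, -1}"
  by (auto simp: homogeneous_def has_weight_def)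

lemma homogeneous_tone: "homogeneous 0 tone"
  by (rule homogeneousI) (auto simp: tone_def split: if_splits)

lemma homogeneous_yvec: "i \<in> {1, -1} \<Longrightarrow> homogeneous i (yvec i)"
  by (rule homogeneousI) (auto simp: yvec_def split: if_splits)

lemma homogeneous_scale: "homogeneous i b \<Longrightarrow> homogeneous i (r \<cdot>\<^sub>t b)"
  by (auto simp: homogeneous_def has_weight_def scale_apply)

lemma homogeneous_diff: "homogeneous i b \<Longrightarrow> homogeneous i c \<Longrightarrow> homogeneous i (b - c)"
  unfolding homogeneous_def has_weight_def by (metis diff_self minus_apply)

lemma homogeneous_tensor:
  assumes "homogeneous i b" "homogeneous j c"
  shows "homogeneous (i + j) (b \<otimes>\<^sub>t c)"
proof (rule homogeneousI)
  fix w assume "(b \<otimes>\<^sub>t c) w \<noteq> 0"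
  then obtain k where "b (take k w) * c (drop k w) \<noteq> 0"
    unfolding tensor_def by (meson sum.neutral)
  then have "b (take k w) \<noteq> 0" "c (drop k w) \<noteq> 0" by auto
  then have "sum_list (take k w) = i \<and> set (take k w) \<subseteq> {1, -1}"
    and "sum_list (drop k w) = j \<and> set (drop k w) \<subseteq> {1, -1}"
    using assms homogeneousD by blast+
  then have "sum_list (take k w @ drop k w) = i + j \<and> set (take k w @ drop k w) \<subseteq> {1, -1}"
    unfolding sum_list_append set_append by auto
  then show "sum_list w = i + j \<and> set w \<subseteq> {1, -1}" by simp
qed

lemma homogeneous_Psi:
  assumes "homogeneous i b"
  shows "homogeneous i (Psi v b)"
  unfolding Psi_def
  using homogeneous_tensor[OF homogeneous_yvec[of 1] homogeneous_tensor[OF assms homogeneous_yvec[of "-1"]]]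
    homogeneous_tensor[OF homogeneous_yvec[of "-1"] homogeneous_tensor[OF assms homogeneous_yvec[of 1]]]
  by (auto intro!: homogeneous_diff homogeneous_scale)

section \<open>The action of \<open>F\<close>\<close>

lemma op_tensor_Cons: "op_tensor (A # As) (i # w) = A i \<otimes>\<^sub>t op_tensor As w"
  by (simp add: op_tensor_def)

text \<open>
  All tensor powers of \<open>K\<^sup>-\<^sup>1\<close> are diagonal and depend on a word only through its weight.
\<close>

lemma op_tensor_Kinv:
  assumes "v \<noteq> 0"
  shows "op_tensor (replicate (length w) (Kinv_V v)) w =
    v powi (- sum_list w) \<cdot>\<^sub>t (\<lambda>u. if u = w then 1 else 0)"
proof (induction w)
  case Nil
  show ?case by (auto simp: op_tensor_def tone_def scale_apply)
next
  case (Cons i w)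
  show ?case
  proof
    fix u
    show "op_tensor (replicate (length (i # w)) (Kinv_V v)) (i # w) u =
      (v powi (- sum_list (i # w)) \<cdot>\<^sub>t (\<lambda>u. if u = i # w then 1 else 0)) u"
      using assms
      by (cases u) (auto simp: op_tensor_Cons Cons.IH Kinv_V_def tensor_scale_left
          tensor_scale_right yvec_tensor_Nil yvec_tensor_Cons scale_apply power_int_minus
          power_int_add field_simps power_int_diff)
  qed
qed

text \<open>
  The coproduct of \<open>F\<close>: either \<open>F\<close> hits the first letter and \<open>K\<^sup>-\<^sup>1\<close> acts on all others, or the first
  letter stays and \<open>F\<close> acts on the rest.
\<close>

lemma F_word_Cons:
  "F_word v (i # w) = F_V i \<otimes>\<^sub>t op_tensor (replicate (length w) (Kinv_V v)) w
     + yvec i \<otimes>\<^sub>t F_word v w"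
proof -
  have "(\<Sum>j=Suc 1..Suc (length w).
          op_tensor (replicate (j - 1) yvec @ [F_V] @ replicate (Suc (length w) - j) (Kinv_V v)) (i # w))
      = (\<Sum>j=1..length w. yvec i \<otimes>\<^sub>t
          op_tensor (replicate (j - 1) yvec @ [F_V] @ replicate (length w - j) (Kinv_V v)) w)"
    unfolding sum.shift_bounds_cl_Suc_ivl
  proof (rule sum.cong)
    fix j assume "j \<in> {1..length w}"
    then obtain k where "j = Suc k" by (cases j) auto
    then show "op_tensor (replicate (Suc j - 1) yvec @ [F_V] @
          replicate (Suc (length w) - Suc j) (Kinv_V v)) (i # w) =
        yvec i \<otimes>\<^sub>t op_tensor (replicate (j - 1) yvec @ [F_V] @
          replicate (length w - j) (Kinv_V v)) w"
      by (simp add: op_tensor_Cons)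
  qed simp
  moreover have "F_word v (i # w) = op_tensor (F_V # replicate (length w) (Kinv_V v)) (i # w) +
      (\<Sum>j=Suc 1..Suc (length w).
          op_tensor (replicate (j - 1) yvec @ [F_V] @ replicate (Suc (length w) - j) (Kinv_V v)) (i # w))"
    unfolding F_word_def length_Cons by (subst sum.atLeast_Suc_atMost) simp_all
  ultimately show ?thesis
    by (simp only: op_tensor_Cons) (simp only: F_word_def tensor_sum_right)
qed

lemma words_0: "words 0 = {[]}"
  by (auto simp: words_def)

lemma words_Suc: "words (Suc m) = (#) 1 ` words m \<union> (#) (-1) ` words m"
  by (auto simp: words_def length_Suc_conv)

lemma finite_words: "finite (words m)"
  by (induction m) (auto simp: words_0 words_Suc)

lemma sum_words_Suc:
  "(\<Sum>w\<in>words (Suc m). f w) = (\<Sum>w\<in>words m. f (1 # w)) + (\<Sum>w\<in>words m. f (-1 # w))"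
  unfolding words_Suc
  by (subst sum.union_disjoint) (auto simp: finite_words sum.reindex)

lemma F_act_Nil: "F_act v b [] = 0"
  by (simp add: F_act_def words_0 F_word_def)

text \<open>
  How \<open>F\<close> commutes with contraction. Together with \<open>F_act_Nil\<close> this determines \<open>F\<close> by
  recursion on the word at which the value is taken.
\<close>

lemma F_act_Cons:
  assumes "v \<noteq> 0" and b: "homogeneous d b"
  shows "F_act v b (x # u) =
    (if x = -1 then v powi (- sum_list u) * b (1 # u) else 0) + F_act v (\<lambda>w. b (x # w)) u"
proof -
  have 1: "F_word v (1 # w) (x # u) =
      (if x = -1 \<and> u = w then v powi (- sum_list u) else 0) + (if x = 1 then F_word v w u else 0)" for w x
    by (auto simp: F_word_Cons F_V_def yvec_tensor_Cons op_tensor_Kinv[OF assms(1)] scale_apply)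
  have m1: "F_word v (-1 # w) (x # u) = (if x = -1 then F_word v w u else 0)" for w x
    by (auto simp: F_word_Cons F_V_def yvec_tensor_Cons)
  have u: "b (1 # u) = 0" if "u \<notin> words (length u)"
    using homogeneousD[OF b, of "1 # u"] that by (auto simp: words_def)
  have x: "b (x # w) = 0" if "x \<noteq> 1" "x \<noteq> -1" for w
    using homogeneousD[OF b, of "x # w"] that by auto
  \<comment> \<open>If \<open>u\<close> is not a word, the first summand is absent from the sum over words; the coefficient
      \<open>b (1 # u)\<close> then vanishes as well.\<close>
  show ?thesis
    using u x unfolding F_act_def
    by (cases "u \<in> words (length u)"; cases "x = 1"; cases "x = -1")
      (simp_all add: sum_words_Suc 1 m1 finite_words if_distrib[of "(*) c" for c] mult.commute cong: if_cong)
qed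

lemma F_act_add: "F_act v (b + c) = F_act v b + F_act v c"
  by (rule ext) (simp add: F_act_def distrib_right sum.distrib)

lemma F_act_diff: "F_act v (b - c) = F_act v b - F_act v c"
  by (rule ext) (simp add: F_act_def left_diff_distrib sum_subtractf)

lemma F_act_scale: "F_act v (r \<cdot>\<^sub>t b) = r \<cdot>\<^sub>t F_act v b"
  by (rule ext) (simp add: F_act_def scale_apply sum_distrib_left mult_ac)

lemma F_act_zero [simp]: "F_act v 0 = 0"
  by (rule ext) (simp add: F_act_def)

lemma homogeneous_contraction:
  assumes "homogeneous d b"
  shows "homogeneous (d - x) (\<lambda>w. b (x # w))"
  using homogeneousD[OF assms, of "x # _"] by (fastforce intro: homogeneousI)

text \<open>
  \<open>F\<close> is a twisted derivation: on a right factor of weight \<open>j\<close> the operator \<open>K\<^sup>-\<^sup>1\<close> is the scalar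
  \<open>v\<^sup>-\<^sup>j\<close>. The induction contracts the first letter of \<open>b\<close>; the weight of \<open>c\<close> enters only in
  \<open>twist\<close>, where the weight of a word is split between the two factors.
\<close>

lemma F_act_tensor:
  assumes v: "v \<noteq> 0" and "homogeneous i b" and c: "homogeneous j c"
  shows "F_act v (b \<otimes>\<^sub>t c) = v powi (- j) \<cdot>\<^sub>t (F_act v b \<otimes>\<^sub>t c) + b \<otimes>\<^sub>t F_act v c"
proof
  fix u
  show "F_act v (b \<otimes>\<^sub>t c) u = (v powi (- j) \<cdot>\<^sub>t (F_act v b \<otimes>\<^sub>t c) + b \<otimes>\<^sub>t F_act v c) u"
    using assms(2)
  proof (induction u arbitrary: b i)
    case Nil
    show ?case by (simp add: F_act_Nil tensor_Nil scale_apply)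
  next
    case (Cons x u)
    let ?b = "\<lambda>x w. b (x # w)"
    let ?q = "\<lambda>w. v powi (- sum_list w) * b (1 # w)"
    have bx: "(\<lambda>w. (b \<otimes>\<^sub>t c) (x # w)) = b [] \<cdot>\<^sub>t (\<lambda>w. c (x # w)) + ?b x \<otimes>\<^sub>t c"
      by (rule ext) (simp add: tensor_Cons scale_apply)
    have Fx: "(\<lambda>w. F_act v b (x # w)) = (if x = -1 then 1 else 0) \<cdot>\<^sub>t ?q + F_act v (?b x)"
      by (rule ext) (simp add: F_act_Cons[OF v Cons.prems] scale_apply)
    \<comment> \<open>In each summand of the tensor product at \<open>u\<close>, the part of \<open>u\<close> read by \<open>c\<close> has sum \<open>j\<close>.\<close>
    have twist: "v powi (- sum_list u) * (?b 1 \<otimes>\<^sub>t c) u = v powi (- j) * (?q \<otimes>\<^sub>t c) u"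
      unfolding tensor_def sum_distrib_left
    proof (rule sum.cong)
      fix k
      have "sum_list u = sum_list (take k u) + j" if "c (drop k u) \<noteq> 0"
        using homogeneousD[OF c that] sum_list_append[of "take k u" "drop k u"] by simp
      then show "v powi (- sum_list u) * (b (1 # take k u) * c (drop k u)) =
          v powi (- j) * (v powi (- sum_list (take k u)) * b (1 # take k u) * c (drop k u))"
        using v by (cases "c (drop k u) = 0")
          (auto simp: power_int_minus power_int_add power_int_diff field_simps)
    qed simp
    have "F_act v (b \<otimes>\<^sub>t c) (x # u) =
        (if x = -1 then v powi (- sum_list u) * (b [] * c (1 # u) + (?b 1 \<otimes>\<^sub>t c) u) else 0)
        + (b [] * F_act v (\<lambda>w. c (x # w)) u + F_act v (?b x \<otimes>\<^sub>t c) u)"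
      unfolding F_act_Cons[OF v homogeneous_tensor[OF Cons.prems c]] bx
      by (simp add: F_act_add F_act_scale scale_apply tensor_Cons)
    also have "F_act v (?b x \<otimes>\<^sub>t c) u =
        v powi (- j) * (F_act v (?b x) \<otimes>\<^sub>t c) u + (?b x \<otimes>\<^sub>t F_act v c) u"
      by (simp add: Cons.IH[OF homogeneous_contraction[OF Cons.prems]] scale_apply)
    finally show ?case
      using twist
      by (auto simp: tensor_Cons Fx tensor_add_left tensor_scale_left F_act_Nil
          F_act_Cons[OF v c] scale_apply algebra_simps)
  qed
qed

lemma F_act_tone [simp]: "F_act v tone = 0"
proof
  show "F_act v tone u = 0 u" for u
    by (auto simp: F_act_def tone_def F_word_def words_def intro!: sum.neutral)
qed

lemma F_act_yvec:
  assumes "v \<noteq> 0" "i \<in> {1, -1}"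
  shows "F_act v (yvec i) = F_V i"
proof
  have c: "(\<lambda>w. yvec i (x # w)) = (if x = i then 1 else 0) \<cdot>\<^sub>t tone" for x
    by (auto simp: yvec_def tone_def scale_apply)
  show "F_act v (yvec i) u = F_V i u" for u
  proof (cases u)
    case Nil
    then show ?thesis by (simp add: F_act_Nil F_V_def yvec_def)
  next
    case (Cons x u')
    then show ?thesis
      by (auto simp: F_act_Cons[OF assms(1) homogeneous_yvec[OF assms(2)]] c F_act_scale)
        (auto simp: F_V_def yvec_def scale_apply)
  qed
qed

text \<open>
  Links are killed by \<open>F\<close>: the two terms of \<open>Psi\<close> both map to multiples of \<open>y\<^sub>-\<^sub>1 \<otimes> b \<otimes> y\<^sub>-\<^sub>1\<close>,
  and the coefficient \<open>v\<close> in \<open>Psi\<close> balances the factor that \<open>K\<^sup>-\<^sup>1\<close> produces on \<open>y\<^sub>-\<^sub>1\<close>.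
\<close>

lemma F_act_Psi:
  assumes v: "v \<noteq> 0" and b: "homogeneous 0 b" and F: "F_act v b = 0"
  shows "F_act v (Psi v b) = 0"
proof -
  have bi: "homogeneous i (b \<otimes>\<^sub>t yvec i)" if "i \<in> {1, -1}" for i
    using homogeneous_tensor[OF b homogeneous_yvec[OF that]] by simp
  have "F_act v (yvec 1 \<otimes>\<^sub>t b \<otimes>\<^sub>t yvec (-1)) = v \<cdot>\<^sub>t (yvec (-1) \<otimes>\<^sub>t b \<otimes>\<^sub>t yvec (-1))"
    by (simp add: F_act_tensor[OF v homogeneous_yvec bi] F_act_tensor[OF v b homogeneous_yvec]
        F_act_yvec[OF v] F F_V_def)
  moreover have "F_act v (yvec (-1) \<otimes>\<^sub>t b \<otimes>\<^sub>t yvec 1) = yvec (-1) \<otimes>\<^sub>t b \<otimes>\<^sub>t yvec (-1)"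
    by (simp add: F_act_tensor[OF v homogeneous_yvec bi] F_act_tensor[OF v b homogeneous_yvec]
        F_act_yvec[OF v] F F_V_def scale_apply zero_fun_def[symmetric])
  ultimately show ?thesis
    by (simp add: Psi_def F_act_diff F_act_scale)
qed

section \<open>Decompositions of \<open>1\<close>-factors\<close>

lemma one_factor_Nil [simp]: "one_factor []"
  by (simp add: one_factor_def)

lemma one_factor_append:
  assumes "one_factor \<alpha>"
  shows "one_factor (\<alpha> @ \<beta>) \<longleftrightarrow>
    set \<beta> \<subseteq> {1, -1} \<and> (\<forall>i\<le>length \<beta>. 0 \<le> sum_list \<alpha> + sum_list (take i \<beta>))"
    (is "?L \<longleftrightarrow> ?R")
proof
  assume ?L
  then have "set \<beta> \<subseteq> {1, -1}" by (simp add: one_factor_def)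
  moreover have "0 \<le> sum_list \<alpha> + sum_list (take i \<beta>)" if "i \<le> length \<beta>" for i
  proof -
    have "0 \<le> sum_list (take (length \<alpha> + i) (\<alpha> @ \<beta>))"
      using \<open>?L\<close> that unfolding one_factor_def by (metis add_le_cancel_left length_append)
    then show ?thesis by simp
  qed
  ultimately show ?R by simp
next
  assume R: ?R
  have "0 \<le> sum_list (take i (\<alpha> @ \<beta>))" if "i \<le> length (\<alpha> @ \<beta>)" for i
  proof (cases "i \<le> length \<alpha>")
    case True
    then show ?thesis using assms by (simp add: one_factor_def)
  next
    case False
    then show ?thesis using R that by simp
  qed
  then show ?L using R assms by (simp add: one_factor_def)
qed

lemma one_factor_sum_nonneg: "one_factor \<alpha> \<Longrightarrow> 0 \<le> sum_list \<alpha>"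
  unfolding one_factor_def by (metis order_refl take_all)

lemma one_factor_append_one_factor:
  "one_factor \<alpha> \<Longrightarrow> one_factor \<beta> \<Longrightarrow> one_factor (\<alpha> @ \<beta>)"
  using one_factor_sum_nonneg[of \<alpha>] by (simp add: one_factor_append) (simp add: one_factor_def)

lemma one_factor_snoc:
  assumes "one_factor \<alpha>"
  shows "one_factor (\<alpha> @ [x]) \<longleftrightarrow> x \<in> {1, -1} \<and> 0 \<le> sum_list \<alpha> + x"
proof -
  have "(\<forall>i\<le>length [x]. P i) \<longleftrightarrow> P 0 \<and> P 1" for P
    by (auto simp: le_Suc_eq)
  then show ?thesis
    using one_factor_sum_nonneg[OF assms] by (auto simp: one_factor_append[OF assms])
qed

lemma one_factor_single [simp]: "one_factor [1]"
  using one_factor_snoc[of "[]" 1] by simp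

lemma one_factor_Cons: "one_factor \<alpha> \<Longrightarrow> one_factor (1 # \<alpha>)"
  using one_factor_append_one_factor[of "[1]" \<alpha>] by simp

lemma one_factor_link:
  assumes "one_factor \<beta>" "sum_list \<beta> = 0"
  shows "one_factor (1 # \<beta> @ [-1])"
  using one_factor_snoc[OF one_factor_Cons[OF assms(1)], of "-1"] assms(2) by simp

text \<open>
  A sequence that fails to be a \<open>1\<close>-factor has a first partial sum equal to \<open>-1\<close>; since the steps
  are \<open>1\<close> and \<open>-1\<close>, the part before it is balanced.
\<close>

lemma one_factor_or_descent:
  assumes "set xs \<subseteq> {1, -1}"
  shows "one_factor xs \<or> (\<exists>\<beta> \<gamma>. xs = \<beta> @ -1 # \<gamma> \<and> one_factor \<beta> \<and> sum_list \<beta> = 0)"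
  using assms
proof (induction xs rule: rev_induct)
  case Nil
  show ?case by simp
next
  case (snoc x xs)
  show ?case
  proof (cases "one_factor xs")
    case True
    show ?thesis
    proof (cases "x = -1 \<and> sum_list xs = 0")
      case False
      then have "one_factor (xs @ [x])"
        using snoc.prems one_factor_sum_nonneg[OF True] by (auto simp: one_factor_snoc[OF True])
      then show ?thesis ..
    qed (use True in blast)
  next
    case False
    then obtain \<beta> \<gamma> where "xs = \<beta> @ -1 # \<gamma>" "one_factor \<beta>" "sum_list \<beta> = 0"
      using snoc by auto
    then have "xs @ [x] = \<beta> @ -1 # (\<gamma> @ [x])" by simp
    then show ?thesis using \<open>one_factor \<beta>\<close> \<open>sum_list \<beta> = 0\<close> by blast
  qed
qed

text \<open>
  After its first letter \<open>1\<close>, a \<open>1\<close>-factor either never returns to \<open>0\<close>, so that this letter is a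
  defect, or it returns for the first time at the end of the link that starts there. These are
  the two cases in the recursion of \<open>eta\<close>.
\<close>

lemma one_factor_cases:
  assumes "one_factor \<alpha>"
  obtains "\<alpha> = []"
  | \<gamma> where "\<alpha> = 1 # \<gamma>" "one_factor \<gamma>"
  | \<beta> \<gamma> where "\<alpha> = 1 # \<beta> @ -1 # \<gamma>" "one_factor \<beta>" "sum_list \<beta> = 0" "one_factor \<gamma>"
proof (cases \<alpha>)
  case Nil
  then show thesis using that by blast
next
  case (Cons x xs)
  have "0 \<le> sum_list (take 1 \<alpha>)"
    using assms Cons unfolding one_factor_def by (metis One_nat_def Suc_leI length_Cons zero_less_Suc)
  then have x: "x = 1"
    using assms Cons by (auto simp: one_factor_def)
  have xs: "set xs \<subseteq> {1, -1}"
    using assms Cons by (simp add: one_factor_def)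
  show thesis
  proof (cases "one_factor xs")
    case True
    then show thesis using that(2) Cons x by blast
  next
    case False
    then obtain \<beta> \<gamma> where *: "xs = \<beta> @ -1 # \<gamma>" "one_factor \<beta>" "sum_list \<beta> = 0"
      using one_factor_or_descent[OF xs] by blast
    have link: "one_factor ((1 # \<beta>) @ [-1])"
      using one_factor_link[OF *(2,3)] by simp
    have "one_factor (((1 # \<beta>) @ [-1]) @ \<gamma>)"
      using assms Cons x * by simp
    then have "one_factor \<gamma>"
      unfolding one_factor_append[OF link] by (simp add: * one_factor_def)
    then show thesis using that(3) Cons x * by blast
  qed
qed

lemma one_factor_induct [consumes 1, case_names Nil defect link]:
  assumes "one_factor \<alpha>"
    and Nil: "P []"
    and defect: "\<And>\<gamma>. one_factor \<gamma> \<Longrightarrow> P \<gamma> \<Longrightarrow> P (1 # \<gamma>)"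
    and link: "\<And>\<beta> \<gamma>. one_factor \<beta> \<Longrightarrow> sum_list \<beta> = 0 \<Longrightarrow> one_factor \<gamma> \<Longrightarrow> P \<beta> \<Longrightarrow> P \<gamma> \<Longrightarrow>
      P (1 # \<beta> @ -1 # \<gamma>)"
  shows "P \<alpha>"
  using assms(1)
proof (induction "length \<alpha>" arbitrary: \<alpha> rule: less_induct)
  case less
  from less.prems show ?case
  proof (cases rule: one_factor_cases)
    case 1
    then show ?thesis using Nil by simp
  next
    case (2 \<gamma>)
    then show ?thesis using defect less.hyps by simp
  next
    case (3 \<beta> \<gamma>)
    then show ?thesis using link less.hyps by simp
  qed
qed

text \<open>
  The mirror image of the previous analysis: the last defect is the letter after which everything
  is balanced.
\<close>

lemma last_defect_decomposition:
  assumes "one_factor \<alpha>" "0 < sum_list \<alpha>"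
  obtains \<alpha>' \<beta> where "\<alpha> = \<alpha>' @ 1 # \<beta>" "one_factor \<alpha>'" "one_factor \<beta>" "sum_list \<beta> = 0"
proof -
  have "\<exists>\<alpha>' \<beta>. \<alpha> = \<alpha>' @ 1 # \<beta> \<and> one_factor \<alpha>' \<and> one_factor \<beta> \<and> sum_list \<beta> = 0"
    using assms
  proof (induction rule: one_factor_induct)
    case Nil
    then show ?case by simp
  next
    case (defect \<gamma>)
    show ?case
    proof (cases "sum_list \<gamma> = 0")
      case True
      then have "1 # \<gamma> = [] @ 1 # \<gamma> \<and> one_factor [] \<and> one_factor \<gamma> \<and> sum_list \<gamma> = 0"
        using defect.hyps by simp
      then show ?thesis by blast
    next
      case False
      then obtain \<alpha>' \<beta> where "\<gamma> = \<alpha>' @ 1 # \<beta> \<and> one_factor \<alpha>' \<and> one_factor \<beta> \<and> sum_list \<beta> = 0"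
        using defect.IH one_factor_sum_nonneg[OF defect.hyps] by fastforce
      then have "1 # \<gamma> = (1 # \<alpha>') @ 1 # \<beta> \<and> one_factor (1 # \<alpha>') \<and> one_factor \<beta> \<and> sum_list \<beta> = 0"
        by (simp add: one_factor_Cons)
      then show ?thesis by blast
    qed
  next
    case (link \<beta>' \<gamma>)
    then obtain \<alpha>' \<beta> where *: "\<gamma> = \<alpha>' @ 1 # \<beta>" "one_factor \<alpha>'" "one_factor \<beta>" "sum_list \<beta> = 0"
      by auto
    from one_factor_append_one_factor[OF one_factor_link[OF link.hyps(1,2)] *(2)]
    have "1 # \<beta>' @ -1 # \<gamma> = (1 # \<beta>' @ -1 # \<alpha>') @ 1 # \<beta> \<and> one_factor (1 # \<beta>' @ -1 # \<alpha>')
        \<and> one_factor \<beta> \<and> sum_list \<beta> = 0"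
      using * by simp
    then show ?case by blast
  qed
  then show thesis using that by blast
qed

section \<open>Pairings and the recursion for \<open>eta\<close>\<close>

lemma pairing_Cons_Suc: "pairing (x # \<alpha>) (Suc i) (Suc j) \<longleftrightarrow> pairing \<alpha> i j"
proof -
  have "(\<Sum>k=Suc i..Suc j. (x # \<alpha>) ! k) = (\<Sum>k=i..j. \<alpha> ! k)" for j
    by (simp add: sum.shift_bounds_cl_Suc_ivl del: sum.cl_ivl_Suc)
  moreover have "(\<forall>j'. Suc i < j' \<and> j' < Suc j \<longrightarrow> Q j') \<longleftrightarrow> (\<forall>j'. i < j' \<and> j' < j \<longrightarrow> Q (Suc j'))" for Q
    by (metis Suc_lessE Suc_mono Suc_less_eq)
  ultimately show ?thesis by (simp add: pairing_def del: sum.cl_ivl_Suc)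
qed

lemma pairing_append_shift:
  "pairing (\<beta> @ \<alpha>) (length \<beta> + i) (length \<beta> + j) \<longleftrightarrow> pairing \<alpha> i j"
  by (induction \<beta>) (simp_all add: pairing_Cons_Suc)

lemma sum_nth_eq_sum_take:
  fixes \<alpha> :: "int list"
  shows "j < length \<alpha> \<Longrightarrow> (\<Sum>k=0..j. \<alpha> ! k) = sum_list (take (Suc j) \<alpha>)"
  by (induction j) (simp_all add: take_Suc_conv_app_nth)

lemma pairing_append_left:
  assumes "pairing \<beta> i j"
  shows "pairing (\<beta> @ \<alpha>) i j"
proof -
  have "(\<Sum>k=i..j'. (\<beta> @ \<alpha>) ! k) = (\<Sum>k=i..j'. \<beta> ! k)" if "j' \<le> j" for j'
    using assms that by (intro sum.cong) (auto simp: pairing_def nth_append)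
  then show ?thesis
    using assms by (auto simp: pairing_def nth_append)
qed

lemma pairing_right_unique: "pairing \<alpha> i j \<Longrightarrow> pairing \<alpha> i k \<Longrightarrow> j = k"
  unfolding pairing_def by (meson linorder_neqE_nat)

lemma not_pairing_one_factor: "one_factor \<gamma> \<Longrightarrow> \<not> pairing (1 # \<gamma>) 0 j"
proof
  assume "one_factor \<gamma>" and p: "pairing (1 # \<gamma>) 0 j"
  then have "(\<Sum>k=0..j. (1 # \<gamma>) ! k) = 0" "j < length (1 # \<gamma>)" by (auto simp: pairing_def)
  then have "1 + sum_list (take j \<gamma>) = 0" by (simp only: sum_nth_eq_sum_take) simp
  moreover have "0 \<le> sum_list (take j \<gamma>)"
    using \<open>one_factor \<gamma>\<close> \<open>j < length (1 # \<gamma>)\<close> by (simp add: one_factor_def)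
  ultimately show False by simp
qed

lemma pairing_link:
  assumes \<beta>: "one_factor \<beta>" "sum_list \<beta> = 0"
  shows "pairing (1 # \<beta> @ -1 # \<gamma>) 0 j \<longleftrightarrow> j = Suc (length \<beta>)"
proof -
  let ?\<alpha> = "1 # \<beta> @ -1 # \<gamma>"
  have "(\<Sum>k=0..j'. ?\<alpha> ! k) \<noteq> 0" if "j' < Suc (length \<beta>)" for j'
  proof -
    have "(\<Sum>k=0..j'. ?\<alpha> ! k) = 1 + sum_list (take j' \<beta>)"
      using that by (subst sum_nth_eq_sum_take) simp_all
    moreover have "0 \<le> sum_list (take j' \<beta>)"
      using that \<beta> by (simp add: one_factor_def)
    ultimately show ?thesis by simp
  qed
  moreover have "(\<Sum>k=0..Suc (length \<beta>). ?\<alpha> ! k) = 0"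
    using \<beta> by (subst sum_nth_eq_sum_take) simp_all
  ultimately have "pairing ?\<alpha> 0 (Suc (length \<beta>))"
    by (auto simp: pairing_def simp del: sum.cl_ivl_Suc)
  then show ?thesis using pairing_right_unique by blast
qed

lemma eta_defect: "one_factor \<gamma> \<Longrightarrow> eta v (1 # \<gamma>) = yvec 1 \<otimes>\<^sub>t eta v \<gamma>"
  using not_pairing_one_factor by (auto simp: defect_def) (auto simp: pairing_def)

lemma eta_link:
  assumes "one_factor \<beta>" "sum_list \<beta> = 0"
  shows "eta v (1 # \<beta> @ -1 # \<gamma>) = Psi v (eta v \<beta>) \<otimes>\<^sub>t eta v \<gamma>"
proof -
  have "\<not> defect (1 # \<beta> @ -1 # \<gamma>) 0"
    using pairing_link[OF assms, of \<gamma>] by (auto simp: defect_def)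
  moreover have "(THE j. pairing (1 # \<beta> @ -1 # \<gamma>) 0 j) = Suc (length \<beta>)"
    by (simp add: pairing_link[OF assms])
  ultimately show ?thesis by (simp add: Let_def)
qed

text \<open>
  The recursion through \<open>defect\<close> and \<open>pairing\<close> is now replaced by \<open>eta_defect\<close> and \<open>eta_link\<close>.
\<close>

declare eta.simps(2) [simp del]

text \<open>
  No pairing connects \<open>\<alpha>\<close> with \<open>\<delta>\<close>: partial sums of the \<open>1\<close>-factor \<open>\<delta>\<close> are nonnegative, so the
  defects of \<open>\<alpha>\<close> remain unpaired.
\<close>

lemma eta_append:
  assumes "one_factor \<alpha>" and \<delta>: "one_factor \<delta>"
  shows "eta v (\<alpha> @ \<delta>) = eta v \<alpha> \<otimes>\<^sub>t eta v \<delta>"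
  using assms(1)
  by (induction rule: one_factor_induct)
    (simp_all add: eta_defect eta_link tensor_assoc one_factor_append_one_factor \<delta>)

lemma homogeneous_eta: "one_factor \<alpha> \<Longrightarrow> homogeneous (sum_list \<alpha>) (eta v \<alpha>)"
proof (induction rule: one_factor_induct)
  case Nil
  show ?case by (simp add: homogeneous_tone)
next
  case (defect \<gamma>)
  then show ?case
    using homogeneous_tensor[OF homogeneous_yvec[of 1]] by (simp add: eta_defect)
next
  case (link \<beta> \<gamma>)
  then show ?case
    using homogeneous_tensor[OF homogeneous_Psi] by (fastforce simp: eta_link)
qed

lemma F_act_eta_balanced:
  assumes "v \<noteq> 0" "one_factor \<alpha>" "sum_list \<alpha> = 0"
  shows "F_act v (eta v \<alpha>) = 0"
  using assms(2,3)
proof (induction rule: one_factor_induct)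
  case Nil
  show ?case by simp
next
  case (defect \<gamma>)
  then show ?case using one_factor_sum_nonneg[of \<gamma>] by simp
next
  case (link \<beta> \<gamma>)
  have \<beta>: "homogeneous 0 (eta v \<beta>)" and \<gamma>: "homogeneous 0 (eta v \<gamma>)"
    using link.prems link.hyps homogeneous_eta[of \<beta> v] homogeneous_eta[of \<gamma> v] by auto
  have "F_act v (eta v \<beta>) = 0" "F_act v (eta v \<gamma>) = 0"
    using link by auto
  then show ?case
    unfolding eta_link[OF link.hyps(1,2)] F_act_tensor[OF assms(1) homogeneous_Psi[OF \<beta>] \<gamma>]
    by (simp only: F_act_Psi[OF assms(1) \<beta>] tensor_zero_left tensor_zero_right scale_zero add_0)
qed

section \<open>Positions of the defects\<close>

lemma balanced_paired:
  assumes "one_factor \<beta>" "sum_list \<beta> = 0" "i < length \<beta>"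
  shows "if \<beta> ! i = 1 then \<exists>j. pairing \<beta> i j else \<exists>j. pairing \<beta> j i"
  using assms
proof (induction arbitrary: i rule: one_factor_induct)
  case Nil
  then show ?case by simp
next
  case (defect \<gamma>)
  then show ?case using one_factor_sum_nonneg[of \<gamma>] by simp
next
  case (link \<beta> \<gamma>)
  let ?\<alpha> = "1 # \<beta> @ -1 # \<gamma>"
  note outer = pairing_link[OF link.hyps(1,2), of \<gamma>]
  have left: "pairing ?\<alpha> (Suc k) (Suc l)" if "pairing \<beta> k l" for k l
    using pairing_append_left[OF that] by (simp add: pairing_Cons_Suc)
  have right: "pairing ?\<alpha> (length \<beta> + 2 + k) (length \<beta> + 2 + l)" if "pairing \<gamma> k l" for k l
    using that pairing_append_shift[of "1 # \<beta> @ [-1]" \<gamma> k l] by simp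
  consider "i = 0" | k where "i = Suc k" "k < length \<beta>" | "i = Suc (length \<beta>)"
    | k where "i = length \<beta> + 2 + k" "k < length \<gamma>"
  proof -
    have "\<exists>k. i = length \<beta> + 2 + k \<and> k < length \<gamma>" if "Suc (length \<beta>) < i"
      using that link.prems by (intro exI[of _ "i - (length \<beta> + 2)"]) auto
    moreover have "i = 0 \<or> (\<exists>k. i = Suc k \<and> k < length \<beta>) \<or> i = Suc (length \<beta>) \<or> Suc (length \<beta>) < i"
      by (cases i) auto
    ultimately have "i = 0 \<or> (\<exists>k. i = Suc k \<and> k < length \<beta>) \<or> i = Suc (length \<beta>)
        \<or> (\<exists>k. i = length \<beta> + 2 + k \<and> k < length \<gamma>)"
      by argo
    then show thesis using that by (elim disjE exE conjE)
  qed
  then show ?case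
  proof cases
    case 1
    then show ?thesis using outer by auto
  next
    case (2 k)
    then show ?thesis
      using link.IH(1)[OF link.hyps(2) 2(2)] left by (auto simp: nth_append split: if_splits)
  next
    case 3
    then show ?thesis using outer by (auto simp: nth_append)
  next
    case (4 k)
    have "sum_list \<gamma> = 0" using link by simp
    then show ?thesis
      using link.IH(2)[OF _ 4(2)] right 4(1) by (auto simp: nth_append split: if_splits)
  qed
qed

lemma defects_defect:
  assumes "one_factor \<gamma>"
  shows "defects (1 # \<gamma>) = 0 # map Suc (defects \<gamma>)"
proof -
  have "defect (1 # \<gamma>) 0"
    using not_pairing_one_factor[OF assms] by (auto simp: defect_def pairing_def)
  moreover have "defect (1 # \<gamma>) (Suc i) \<longleftrightarrow> defect \<gamma> i" for i
  proof -
    have "pairing (1 # \<gamma>) (Suc i) j \<longleftrightarrow> (\<exists>j'. j = Suc j' \<and> pairing \<gamma> i j')" for j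
      by (cases j) (auto simp: pairing_Cons_Suc, simp add: pairing_def)
    moreover have "pairing (1 # \<gamma>) j (Suc i) \<longleftrightarrow> (\<exists>j'. j = Suc j' \<and> pairing \<gamma> j' i)" for j
      by (cases j) (auto simp: pairing_Cons_Suc not_pairing_one_factor[OF assms])
    ultimately show ?thesis by (auto simp: defect_def)
  qed
  moreover have "[0..<length (1 # \<gamma>)] = 0 # map Suc [0..<length \<gamma>]"
    by (simp add: map_Suc_upt upt_conv_Cons del: upt_Suc)
  ultimately show ?thesis
    by (simp add: defects_def filter_map comp_def del: upt_Suc)
qed

text \<open>
  As every position of \<open>\<beta>\<close> is already paired inside \<open>\<beta>\<close> and right ends are unique, no pairing
  leads from \<open>\<beta>\<close> into \<open>\<delta>\<close>.
\<close>

lemma defects_balanced_append: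
  assumes "one_factor \<beta>" "sum_list \<beta> = 0"
  shows "defects (\<beta> @ \<delta>) = map ((+) (length \<beta>)) (defects \<delta>)"
proof -
  note paired = balanced_paired[OF assms]
  have left: "\<not> defect (\<beta> @ \<delta>) i" if "i < length \<beta>" for i
  proof -
    have "(\<exists>j. pairing \<beta> i j) \<or> (\<exists>j. pairing \<beta> j i)"
      using paired[OF that] by (auto split: if_splits)
    then show ?thesis
      unfolding defect_def using pairing_append_left[of \<beta> _ _ \<delta>] by blast
  qed
  have no_cross: "\<not> pairing (\<beta> @ \<delta>) i (length \<beta> + j)" if i: "i < length \<beta>" for i j
  proof
    assume p: "pairing (\<beta> @ \<delta>) i (length \<beta> + j)"
    then have "\<beta> ! i = 1" using i by (simp add: pairing_def nth_append)
    then obtain k where k: "pairing \<beta> i k" using paired[OF i] by auto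
    then have "k = length \<beta> + j"
      using p pairing_append_left pairing_right_unique by blast
    then show False using k by (simp add: pairing_def)
  qed
  have right: "defect (\<beta> @ \<delta>) (length \<beta> + i) \<longleftrightarrow> defect \<delta> i" for i
  proof -
    have "(\<exists>j. pairing (\<beta> @ \<delta>) (length \<beta> + i) j) \<longleftrightarrow> (\<exists>j. pairing \<delta> i j)"
    proof
      assume "\<exists>j. pairing (\<beta> @ \<delta>) (length \<beta> + i) j"
      then obtain j where j: "pairing (\<beta> @ \<delta>) (length \<beta> + i) j" ..
      then obtain k where "j = length \<beta> + k"
        by (metis pairing_def less_imp_add_positive add.assoc)
      then show "\<exists>j. pairing \<delta> i j" using j by (auto simp: pairing_append_shift)
    qed (blast intro: pairing_append_shift[THEN iffD2])
    moreover have "(\<exists>j. pairing (\<beta> @ \<delta>) j (length \<beta> + i)) \<longleftrightarrow> (\<exists>j. pairing \<delta> j i)"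
    proof
      assume "\<exists>j. pairing (\<beta> @ \<delta>) j (length \<beta> + i)"
      then obtain j where j: "pairing (\<beta> @ \<delta>) j (length \<beta> + i)" ..
      then obtain k where "j = length \<beta> + k"
        using no_cross by (metis not_less nat_le_iff_add)
      then show "\<exists>j. pairing \<delta> j i" using j by (auto simp: pairing_append_shift)
    qed (blast intro: pairing_append_shift[THEN iffD2])
    ultimately show ?thesis by (auto simp: defect_def)
  qed
  have "[0..<length (\<beta> @ \<delta>)] = [0..<length \<beta>] @ map ((+) (length \<beta>)) [0..<length \<delta>]"
    by (auto intro: nth_equalityI simp: nth_append)
  moreover have "filter (defect (\<beta> @ \<delta>)) [0..<length \<beta>] = []"
    using left by (simp add: filter_empty_conv)
  ultimately show ?thesis
    by (simp add: defects_def filter_map comp_def right)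
qed

lemma defects_link:
  assumes "one_factor \<beta>" "sum_list \<beta> = 0"
  shows "defects (1 # \<beta> @ -1 # \<gamma>) = map ((+) (length \<beta> + 2)) (defects \<gamma>)"
  using defects_balanced_append[OF one_factor_link[OF assms], of \<gamma>] assms by simp

lemma defects_append:
  assumes "one_factor \<alpha>" and \<delta>: "one_factor \<delta>"
  shows "defects (\<alpha> @ \<delta>) = defects \<alpha> @ map ((+) (length \<alpha>)) (defects \<delta>)"
  using assms(1)
proof (induction rule: one_factor_induct)
  case Nil
  show ?case by (simp add: defects_def)
next
  case (defect \<gamma>)
  then show ?case
    by (simp add: defects_defect one_factor_append_one_factor[OF _ \<delta>])
next
  case (link \<beta> \<gamma>)
  then show ?case by (simp add: defects_link)
qed

lemma length_defects: "one_factor \<alpha> \<Longrightarrow> int (length (defects \<alpha>)) = sum_list \<alpha>"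
  by (induction rule: one_factor_induct)
    (simp_all add: defects_defect defects_link, simp add: defects_def)

lemma defects_last:
  assumes "one_factor \<alpha>" "one_factor \<beta>" "sum_list \<beta> = 0"
  shows "defects (\<alpha> @ 1 # \<beta>) = defects \<alpha> @ [length \<alpha>]"
proof -
  have "defects \<beta> = []"
    using length_defects[OF assms(2)] assms(3) by simp
  then show ?thesis
    using assms by (simp add: defects_append one_factor_Cons defects_defect)
qed

section \<open>Pairing the last defect\<close>

lemma pair_defect_before_last:
  assumes "one_factor \<alpha>" "one_factor \<beta>" "sum_list \<beta> = 0" "int j < sum_list \<alpha>"
  shows "pair_defect (\<alpha> @ 1 # \<beta>) j = pair_defect \<alpha> j @ 1 # \<beta>"
proof -
  have j: "j < length (defects \<alpha>)"
    using length_defects[OF assms(1)] assms(4) by simp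
  then have "defects \<alpha> ! j < length \<alpha>"
    using nth_mem[OF j] by (auto simp: defects_def)
  then show ?thesis
    using j by (simp add: pair_defect_def defects_last[OF assms(1-3)] nth_append list_update_append)
qed

lemma pair_defect_last:
  assumes "one_factor \<alpha>" "one_factor \<beta>" "sum_list \<beta> = 0" "int j = sum_list \<alpha>"
  shows "pair_defect (\<alpha> @ 1 # \<beta>) j = \<alpha> @ -1 # \<beta>"
proof -
  have "j = length (defects \<alpha>)"
    using length_defects[OF assms(1)] assms(4) by simp
  then show ?thesis
    by (simp add: pair_defect_def defects_last[OF assms(1-3)])
qed

lemma one_factor_last_defect_induct [consumes 1, case_names balanced last_defect]:
  assumes "one_factor \<alpha>"
    and balanced: "\<And>\<alpha>. one_factor \<alpha> \<Longrightarrow> sum_list \<alpha> = 0 \<Longrightarrow> P \<alpha>"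
    and last_defect: "\<And>\<alpha> \<beta>. one_factor \<alpha> \<Longrightarrow> one_factor \<beta> \<Longrightarrow> sum_list \<beta> = 0 \<Longrightarrow> P \<alpha> \<Longrightarrow>
      P (\<alpha> @ 1 # \<beta>)"
  shows "P \<alpha>"
  using assms(1)
proof (induction "length \<alpha>" arbitrary: \<alpha> rule: less_induct)
  case less
  show ?case
  proof (cases "sum_list \<alpha> = 0")
    case True
    then show ?thesis using balanced less.prems by blast
  next
    case False
    then have "0 < sum_list \<alpha>" using one_factor_sum_nonneg[OF less.prems] by simp
    with less.prems obtain \<alpha>' \<beta> where
      *: "\<alpha> = \<alpha>' @ 1 # \<beta>" "one_factor \<alpha>'" "one_factor \<beta>" "sum_list \<beta> = 0"
      by (rule last_defect_decomposition)
    moreover have "P \<alpha>'" using less.hyps *(1,2) by simp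
    ultimately show ?thesis using last_defect by blast
  qed
qed

text \<open>
  Changing a defect to \<open>-1\<close> needs an earlier defect to pair with, whence the lower bound on \<open>j\<close>.
\<close>

lemma one_factor_pair_defect:
  assumes "one_factor \<alpha>" "1 \<le> j" "int j < sum_list \<alpha>"
  shows "one_factor (pair_defect \<alpha> j)"
  using assms(1,3)
proof (induction rule: one_factor_last_defect_induct)
  case (balanced \<alpha>)
  then show ?case by simp
next
  case (last_defect \<alpha> \<beta>)
  show ?case
  proof (cases "int j < sum_list \<alpha>")
    case True
    then show ?thesis
      using last_defect by (simp add: pair_defect_before_last one_factor_append_one_factor one_factor_Cons)
  next
    case False
    then have j: "int j = sum_list \<alpha>" using last_defect by simp
    then have "one_factor (\<alpha> @ [-1])"
      using one_factor_snoc[OF last_defect.hyps(1), of "-1"] assms(2) by simp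
    from one_factor_append_one_factor[OF this last_defect.hyps(2)] show ?thesis
      using last_defect.hyps j by (simp add: pair_defect_last)
  qed
qed

section \<open>The identity for the last defect\<close>

lemma qint_one [simp]: "qint v 1 = 1"
  by (simp add: qint_def)

lemma qint_Suc:
  assumes "v \<noteq> 0"
  shows "v * qint v (int (Suc k)) = v powi int (Suc k) + qint v (int k)"
proof -
  have "v * v powi (int (Suc k) - 1 - 2 * int t) = v powi (int (Suc k) - 2 * int t)" for t
    using assms power_int_add_1'[of v "int (Suc k) - 1 - 2 * int t"] by (simp add: algebra_simps)
  then have "v * qint v (int (Suc k)) = (\<Sum>t<Suc k. v powi (int (Suc k) - 2 * int t))"
    by (simp only: qint_def nat_int of_nat_0_le_iff if_True sum_distrib_left)
  also have "\<dots> = v powi int (Suc k) + (\<Sum>t<k. v powi (int k - 1 - 2 * int t))"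
    by (subst sum.lessThan_Suc_shift) (simp add: algebra_simps)
  finally show ?thesis by (simp add: qint_def)
qed

lemma eta_minus_last:
  assumes "one_factor \<alpha>" "one_factor \<beta>" "sum_list \<beta> = 0"
  shows "eta v ((\<alpha> @ 1 # \<beta>) @ [-1]) = eta v (\<alpha> @ 1 # \<beta>) \<otimes>\<^sub>t yvec (-1)
    - v \<cdot>\<^sub>t (eta v \<alpha> \<otimes>\<^sub>t yvec (-1) \<otimes>\<^sub>t eta v \<beta> \<otimes>\<^sub>t yvec 1)"
proof -
  have "eta v ((\<alpha> @ 1 # \<beta>) @ [-1]) = eta v \<alpha> \<otimes>\<^sub>t Psi v (eta v \<beta>)"
    using eta_append[OF assms(1) one_factor_link[OF assms(2,3)], of v]
      eta_link[OF assms(2,3), of v "[]"] by simp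
  moreover have "eta v (\<alpha> @ 1 # \<beta>) = eta v \<alpha> \<otimes>\<^sub>t yvec 1 \<otimes>\<^sub>t eta v \<beta>"
    by (simp add: eta_append one_factor_Cons eta_defect assms)
  ultimately show ?thesis
    by (simp add: Psi_def tensor_diff_right tensor_scale_right tensor_assoc)
qed

text \<open>
  In \<open>eta (\<alpha> @ 1 # \<beta>) = eta \<alpha> \<otimes> y\<^sub>1 \<otimes> eta \<beta>\<close> the operator \<open>F\<close> hits the first two factors only, and on the
  first one \<open>K\<^sup>-\<^sup>1\<close> contributes the weight \<open>1\<close> of \<open>y\<^sub>1 \<otimes> eta \<beta>\<close>.
\<close>

lemma F_act_eta_last:
  assumes v: "v \<noteq> 0" and "one_factor \<alpha>" "one_factor \<beta>" "sum_list \<beta> = 0"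
  shows "F_act v (eta v (\<alpha> @ 1 # \<beta>)) =
    inverse v \<cdot>\<^sub>t (F_act v (eta v \<alpha>) \<otimes>\<^sub>t yvec 1 \<otimes>\<^sub>t eta v \<beta>) + eta v \<alpha> \<otimes>\<^sub>t yvec (-1) \<otimes>\<^sub>t eta v \<beta>"
proof -
  have \<beta>: "homogeneous 0 (eta v \<beta>)"
    using homogeneous_eta[OF assms(3), of v] assms(4) by simp
  have y: "homogeneous 1 (yvec 1 \<otimes>\<^sub>t eta v \<beta>)"
    using homogeneous_tensor[OF homogeneous_yvec[of 1] \<beta>] by simp
  have "F_act v (yvec 1 \<otimes>\<^sub>t eta v \<beta>) = yvec (-1) \<otimes>\<^sub>t eta v \<beta>"
    by (rule ext) (simp add: F_act_tensor[OF v homogeneous_yvec \<beta>] F_act_yvec[OF v] F_V_def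
        F_act_eta_balanced[OF v assms(3,4)] scale_apply del: zero_fun_apply)
  moreover have "eta v (\<alpha> @ 1 # \<beta>) = eta v \<alpha> \<otimes>\<^sub>t yvec 1 \<otimes>\<^sub>t eta v \<beta>"
    by (simp add: eta_append one_factor_Cons eta_defect assms)
  ultimately show ?thesis
    by (simp add: F_act_tensor[OF v homogeneous_eta[OF assms(2)] y] power_int_minus)
qed

text \<open>
  The core of the proof, for a \<open>1\<close>-factor with \<open>Suc d\<close> defects. In the induction step the new
  \<open>1\<close>-factor is \<open>?\<alpha> @ 1 # \<beta>\<close> and \<open>?\<alpha>\<close> has the \<open>d\<close> defects before its last one. The summands with
  \<open>j < d\<close> pair two defects of \<open>?\<alpha>\<close>; they and the part of \<open>F\<close> that acts on \<open>?\<alpha>\<close> form the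
  induction hypothesis times \<open>y\<^sub>1 \<otimes> eta \<beta>\<close>, which equals \<open>v [d] ?X \<otimes> y\<^sub>1 \<otimes> eta \<beta>\<close>. The summand
  \<open>j = d\<close> pairs the last two defects and is \<open>[d] (?Y - v ?X \<otimes> y\<^sub>1 \<otimes> eta \<beta>)\<close>. The \<open>?X\<close>-terms
  cancel, and \<open>?Y\<close> is left with the coefficient \<open>v\<^sup>d\<^sup>+\<^sup>1 + [d] = v [d+1]\<close>.
\<close>

lemma F_act_eta_plus_paired:
  assumes v: "v \<noteq> 0" and "one_factor \<alpha>" "one_factor \<beta>" "sum_list \<beta> = 0" "int d = sum_list \<alpha>"
  shows "v powi int (Suc d) \<cdot>\<^sub>t F_act v (eta v (\<alpha> @ 1 # \<beta>))
      + (\<Sum>j=1..d. qint v (int j) \<cdot>\<^sub>t eta v (pair_defect (\<alpha> @ 1 # \<beta>) j))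
    = (v * qint v (int (Suc d))) \<cdot>\<^sub>t (eta v \<alpha> \<otimes>\<^sub>t yvec (-1) \<otimes>\<^sub>t eta v \<beta>)"
  using assms(2-)
proof (induction arbitrary: \<beta> d rule: one_factor_last_defect_induct)
  case (balanced \<alpha>)
  then have "F_act v (eta v (\<alpha> @ 1 # \<beta>)) = eta v \<alpha> \<otimes>\<^sub>t yvec (-1) \<otimes>\<^sub>t eta v \<beta>"
    by (simp only: F_act_eta_last[OF v] F_act_eta_balanced[OF v] tensor_zero_left scale_zero add_0)
  then show ?case using balanced by simp
next
  case (last_defect \<alpha> \<beta>')
  let ?\<alpha> = "\<alpha> @ 1 # \<beta>'"
  let ?t = "\<lambda>b. b \<otimes>\<^sub>t yvec 1 \<otimes>\<^sub>t eta v \<beta>"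
  let ?X = "eta v \<alpha> \<otimes>\<^sub>t yvec (-1) \<otimes>\<^sub>t eta v \<beta>'"
  let ?Y = "eta v ?\<alpha> \<otimes>\<^sub>t yvec (-1) \<otimes>\<^sub>t eta v \<beta>"
  have \<alpha>: "one_factor ?\<alpha>"
    using last_defect.hyps by (simp add: one_factor_append_one_factor one_factor_Cons)
  obtain e where d: "d = Suc e" and e: "int e = sum_list \<alpha>"
  proof -
    have "int d = sum_list \<alpha> + 1" using last_defect by simp
    then show thesis
      using that[of "d - 1"] one_factor_sum_nonneg[OF last_defect.hyps(1)] by auto
  qed
  have before: "eta v (pair_defect (?\<alpha> @ 1 # \<beta>) j) = ?t (eta v (pair_defect ?\<alpha> j))"
    if "j \<in> {1..e}" for j
  proof -
    have j: "1 \<le> j" "int j < sum_list ?\<alpha>" using that e last_defect.hyps by auto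
    then show ?thesis
      using last_defect.prems \<alpha>
      by (simp only: pair_defect_before_last eta_append[OF one_factor_pair_defect[OF \<alpha> j]]
          one_factor_Cons eta_defect)
  qed
  have last: "eta v (pair_defect (?\<alpha> @ 1 # \<beta>) d) = ?Y - v \<cdot>\<^sub>t ?t ?X"
  proof -
    have "int d = sum_list ?\<alpha>" using d e last_defect.hyps by simp
    moreover have "one_factor (?\<alpha> @ [-1])"
      unfolding one_factor_snoc[OF \<alpha>] using \<open>int d = sum_list ?\<alpha>\<close> d by simp
    ultimately have "eta v (pair_defect (?\<alpha> @ 1 # \<beta>) d) = eta v (?\<alpha> @ [-1]) \<otimes>\<^sub>t eta v \<beta>"
      using pair_defect_last[OF \<alpha> last_defect.prems(1,2)]
        eta_append[of "?\<alpha> @ [-1]" \<beta> v] last_defect.prems by simp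
    then show ?thesis
      unfolding eta_minus_last[OF last_defect.hyps]
      by (simp only: tensor_diff_left tensor_scale_left tensor_assoc)
  qed
  show ?case
  proof
    fix w
    have "?t (v powi int (Suc e) \<cdot>\<^sub>t F_act v (eta v ?\<alpha>)
        + (\<Sum>j=1..e. qint v (int j) \<cdot>\<^sub>t eta v (pair_defect ?\<alpha> j))) w
      = ?t ((v * qint v (int (Suc e))) \<cdot>\<^sub>t ?X) w"
      by (rule arg_cong[where f = "\<lambda>b. ?t b w", OF last_defect.IH[OF last_defect.hyps(2,3) e]])
    then have "v powi int (Suc e) * ?t (F_act v (eta v ?\<alpha>)) w
        + (\<Sum>j=1..e. qint v (int j) * ?t (eta v (pair_defect ?\<alpha> j)) w)
      = v * qint v (int (Suc e)) * ?t ?X w"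
      by (simp add: tensor_add_left tensor_scale_left tensor_sum_left sum_tensor_apply scale_apply)
    moreover have "(\<Sum>j=1..e. qint v (int j) * eta v (pair_defect (?\<alpha> @ 1 # \<beta>) j) w) =
        (\<Sum>j=1..e. qint v (int j) * ?t (eta v (pair_defect ?\<alpha> j)) w)"
      by (rule sum.cong) (simp_all only: before)
    ultimately have IH: "v powi int (Suc e) * ?t (F_act v (eta v ?\<alpha>)) w
        + (\<Sum>j=1..e. qint v (int j) * eta v (pair_defect (?\<alpha> @ 1 # \<beta>) j) w)
      = v * qint v (int (Suc e)) * ?t ?X w"
      by (simp only:)
    have "v powi int (Suc d) * F_act v (eta v (?\<alpha> @ 1 # \<beta>)) w =
        v powi int (Suc e) * ?t (F_act v (eta v ?\<alpha>)) w + v powi int (Suc d) * ?Y w"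
    proof -
      have "v powi int (Suc d) * inverse v = v powi int (Suc e)"
        unfolding d power_int_of_nat using v by simp
      then show ?thesis
        unfolding F_act_eta_last[OF v \<alpha> last_defect.prems(1,2)] plus_fun_apply scale_apply
        by (simp only: distrib_left flip: mult.assoc)
    qed
    moreover have "(\<Sum>j=1..d. qint v (int j) * eta v (pair_defect (?\<alpha> @ 1 # \<beta>) j) w) =
        (\<Sum>j=1..e. qint v (int j) * eta v (pair_defect (?\<alpha> @ 1 # \<beta>) j) w)
        + qint v (int d) * (?Y w - v * ?t ?X w)"
      using last by (simp add: d scale_apply)
    ultimately show "(v powi int (Suc d) \<cdot>\<^sub>t F_act v (eta v (?\<alpha> @ 1 # \<beta>))
        + (\<Sum>j=1..d. qint v (int j) \<cdot>\<^sub>t eta v (pair_defect (?\<alpha> @ 1 # \<beta>) j))) w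
      = ((v * qint v (int (Suc d))) \<cdot>\<^sub>t ?Y) w"
      using IH unfolding plus_fun_apply scale_apply sum_tensor_apply qint_Suc[OF v, of d]
      by (simp only: d[symmetric]) algebra
  qed
qed

text \<open>
  At the zero vector, whose weight is arbitrary, both sides vanish; hence the formula applies to
  \<open>eta\<close> without a proof that \<open>eta\<close> is nonzero.
\<close>

lemma Phi2_homogeneous:
  assumes "homogeneous i b"
  shows "Phi2 v b = qint v i \<cdot>\<^sub>t (b \<otimes>\<^sub>t yvec (-1)) - v powi i \<cdot>\<^sub>t (F_act v b \<otimes>\<^sub>t yvec 1)"
proof (cases "b = 0")
  case True
  then show ?thesis
    by (simp only: Phi2_def F_act_zero tensor_zero_left scale_zero)
next
  case False
  then obtain w where "b w \<noteq> 0" by (metis ext zero_fun_apply)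
  then have "wt b = i"
    using assms unfolding wt_def homogeneous_def has_weight_def
    by (intro the_equality) auto
  then show ?thesis by (simp add: Phi2_def)
qed

theorem corollary4p8:
  fixes v :: "'k::field" and n d :: nat and \<alpha> :: "int list"
  assumes "v \<noteq> 0"
    and "qfact v n \<noteq> 0"
    and "one_factor \<alpha>"
    and "length \<alpha> < n"
    and "int d = sum_list \<alpha>"
  shows "eta v (\<alpha> @ [1]) = Phi1 (eta v \<alpha>) \<and>
    (d > 0 \<and> qint v (int d) \<noteq> 0 \<longrightarrow>
      eta v (\<alpha> @ [-1]) =
        (1 / qint v (int d)) \<cdot>\<^sub>t Phi2 v (eta v \<alpha>)
        - (\<Sum>j=1..d - 1. (qint v (int j) / qint v (int d)) \<cdot>\<^sub>t Phi1 (eta v (pair_defect \<alpha> j))))"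
proof (intro conjI impI)
  have "eta v [1] = yvec 1"
    using eta_defect[of "[]" v] by simp
  then show "eta v (\<alpha> @ [1]) = Phi1 (eta v \<alpha>)"
    using eta_append[OF assms(3), of "[1]" v] by (simp add: Phi1_def)
next
  assume d: "d > 0 \<and> qint v (int d) \<noteq> 0"
  have "0 < sum_list \<alpha>" using d assms(5) by simp
  with assms(3) obtain \<alpha>' \<beta> where
    \<alpha>: "\<alpha> = \<alpha>' @ 1 # \<beta>" and *: "one_factor \<alpha>'" "one_factor \<beta>" "sum_list \<beta> = 0"
    by (rule last_defect_decomposition)
  obtain e where e: "d = Suc e" using d by (cases d) auto
  then have sum: "int e = sum_list \<alpha>'"
    using assms(5) \<alpha> *(3) by simp
  let ?X = "eta v \<alpha>' \<otimes>\<^sub>t yvec (-1) \<otimes>\<^sub>t eta v \<beta>"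
  let ?S = "\<lambda>w. \<Sum>j=1..e. qint v (int j) * (eta v (pair_defect \<alpha> j) \<otimes>\<^sub>t yvec 1) w"
  show "eta v (\<alpha> @ [-1]) = (1 / qint v (int d)) \<cdot>\<^sub>t Phi2 v (eta v \<alpha>)
        - (\<Sum>j=1..d - 1. (qint v (int j) / qint v (int d)) \<cdot>\<^sub>t Phi1 (eta v (pair_defect \<alpha> j)))"
  proof
    fix w
    have "((v powi int d \<cdot>\<^sub>t F_act v (eta v \<alpha>)
        + (\<Sum>j=1..e. qint v (int j) \<cdot>\<^sub>t eta v (pair_defect \<alpha> j))) \<otimes>\<^sub>t yvec 1) w
      = (((v * qint v (int d)) \<cdot>\<^sub>t ?X) \<otimes>\<^sub>t yvec 1) w"
      using F_act_eta_plus_paired[OF assms(1) * sum] by (simp only: \<alpha> e)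
    then have key: "v powi int d * (F_act v (eta v \<alpha>) \<otimes>\<^sub>t yvec 1) w + ?S w
      = v * qint v (int d) * (?X \<otimes>\<^sub>t yvec 1) w"
      by (simp add: tensor_add_left tensor_scale_left tensor_sum_left sum_tensor_apply scale_apply)
    have "eta v (\<alpha> @ [-1]) w = (eta v \<alpha> \<otimes>\<^sub>t yvec (-1)) w - v * (?X \<otimes>\<^sub>t yvec 1) w"
      unfolding \<alpha> eta_minus_last[OF *] by (simp add: scale_apply tensor_assoc)
    then have "qint v (int d) * eta v (\<alpha> @ [-1]) w =
        qint v (int d) * (eta v \<alpha> \<otimes>\<^sub>t yvec (-1)) w
        - v powi int d * (F_act v (eta v \<alpha>) \<otimes>\<^sub>t yvec 1) w - ?S w"
      using key by algebra
    then have "eta v (\<alpha> @ [-1]) w = (Phi2 v (eta v \<alpha>) w - ?S w) / qint v (int d)"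
      using d homogeneous_eta[OF assms(3), of v]
      by (simp add: Phi2_homogeneous flip: assms(5)) (simp add: scale_apply field_simps)
    then show "eta v (\<alpha> @ [-1]) w = ((1 / qint v (int d)) \<cdot>\<^sub>t Phi2 v (eta v \<alpha>)
        - (\<Sum>j=1..d - 1. (qint v (int j) / qint v (int d)) \<cdot>\<^sub>t Phi1 (eta v (pair_defect \<alpha> j)))) w"
      by (simp add: sum_tensor_apply scale_apply Phi1_def e diff_divide_distrib sum_divide_distrib)
  qed
qed

end
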